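(* Let $n\ge 2$ be an integer. The equation $$v''+\frac{n+1}{r}v'+3r\,v\,v'+(n+2)v^2=0$$ has a solution $V:[0,\infty)\to(0,\infty)$ with $V(0)=1$, $V'(0)=0$ and with the following asymptotics as $r\to\infty$: - if $1<n<4$, then $V(r)\sim r^{-(n+2)/3}$, i.e. $r^{(n+2)/3}V(r)$ converges to a positive constant; - if $n=4$, then $V(r)\sim r^{-2}\left(\frac43\log r+C\right)$ for some constant $C\in\mathbb{R}$, i.e. $r^2V(r)-\frac43\log r\to C$; - if $n>4$, then $V(r)\sim r^{-2}$, i.e. $r^{2}V(r)$ converges to a positive constant.
   Context: Primes denote derivatives with respect to $r$. The equation is required to hold on $(0,\infty)$, with $V$ being $C^1$ up to $r=0$ so that the conditions at $r=0$ make sense. *)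

theory Defs
  imports "HOL-Analysis.Analysis"
begin

(* V is C^1 on the closed half-line (one-sided derivative at 0) with derivative V',
   twice differentiable on the open half-line with second derivative V'', and
   satisfies the equation there.  Values at negative arguments are irrelevant,
   as is V'' 0. *)
definition solves_ode_halfline ::
  "nat \<Rightarrow> (real \<Rightarrow> real) \<Rightarrow> (real \<Rightarrow> real) \<Rightarrow> (real \<Rightarrow> real) \<Rightarrow> bool"
where
  "solves_ode_halfline n V V' V'' \<longleftrightarrow>
     (\<forall>r\<ge>0. (V has_real_derivative V' r) (at r within {0..})) \<and>
     continuous_on {0..} V' \<and>
     (\<forall>r>0. (V' has_real_derivative V'' r) (at r)) \<and>
     (\<forall>r>0. V'' r + (real n + 1) / r * V' r + 3 * r * V r * V' r
               + (real n + 2) * (V r)\<^sup>2 = 0)"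

end

(* Integrating r times the equation once gives r v' + n v = F with
   F(r) = n - (n-1) int_0^r t v^2 dt - (3/2) r^2 v^2, hence the fixed point equation
   v(r) = r^(-n) int_0^r t^(n-1) F(t) dt, which has no singularity at r = 0.  With v replaced
   by its truncation to [0,1] in F, it is a contraction of the bounded continuous functions
   with weight exp(-5 r^2), so a global solution exists.  Always v <= 1; and
   F' = r v (2(n-1) v - 3F) keeps F, and therefore r^n v, positive, so the truncation is void.

   For the asymptotics put w = r^2 v, a solution of an autonomous equation in s = log r:
   w_ss + (n-4)(w_s + w^2) - 2(n-2) w + 3 w w_s = 0.
   With h = (4-n)/3 and m = w_s - h w this reads m_s = (2h - 3w) m + (2h^2 + 2(n-2)) w, and
   m > 0.  If n < 4, then w grows at least like exp(h s), so that m is bounded, and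
   (exp(-h s) w)_s = exp(-h s) m is integrable.  If n = 4, then (4/3 - m)_s = -3w (4/3 - m), so
   w_s - 4/3 decays exponentially.  If n > 4, the parabola w_s = 2w - k w^2 with
   k = (n-4)/(n-2) is a barrier: 0 < w_s < 2w - k w^2, so w increases and stays below 2/k. *)

theory Submission
  imports Defs
begin

section \<open>Comparison of derivatives and antiderivatives\<close>

lemma nonneg_increment:
  fixes f :: "real \<Rightarrow> real"
  assumes "a \<le> b" "\<And>x. a \<le> x \<Longrightarrow> x \<le> b \<Longrightarrow> (f has_real_derivative f' x) (at x)"
    and "\<And>x. a \<le> x \<Longrightarrow> x \<le> b \<Longrightarrow> f' x \<ge> 0"
  shows "f a \<le> f b"
  by (rule DERIV_nonneg_imp_nondecreasing[OF \<open>a \<le> b\<close>]) (use assms in blast)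

text \<open>Integral estimates below take this form: the integrand is compared with the derivative
  of an explicit function, so no integral has to be estimated directly.\<close>

lemma deriv_comparison:
  fixes f g :: "real \<Rightarrow> real"
  assumes "a \<le> b" "f a \<le> g a"
    and f: "\<And>x. a \<le> x \<Longrightarrow> x \<le> b \<Longrightarrow> (f has_real_derivative f' x) (at x)"
    and g: "\<And>x. a \<le> x \<Longrightarrow> x \<le> b \<Longrightarrow> (g has_real_derivative g' x) (at x)"
    and le: "\<And>x. a \<le> x \<Longrightarrow> x \<le> b \<Longrightarrow> f' x \<le> g' x"
  shows "f b \<le> g b"
proof -
  have "(\<lambda>x. g x - f x) a \<le> (\<lambda>x. g x - f x) b"
    by (rule nonneg_increment[where f' = "\<lambda>x. g' x - f' x"])
       (use assms in \<open>auto intro!: DERIV_diff\<close>)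
  then show ?thesis using \<open>f a \<le> g a\<close> by simp
qed

lemma deriv_comparison_abs:
  fixes f g :: "real \<Rightarrow> real"
  assumes "a \<le> b" "f a = 0" "0 \<le> g a"
    and f: "\<And>x. a \<le> x \<Longrightarrow> x \<le> b \<Longrightarrow> (f has_real_derivative f' x) (at x)"
    and g: "\<And>x. a \<le> x \<Longrightarrow> x \<le> b \<Longrightarrow> (g has_real_derivative g' x) (at x)"
    and le: "\<And>x. a \<le> x \<Longrightarrow> x \<le> b \<Longrightarrow> \<bar>f' x\<bar> \<le> g' x"
  shows "\<bar>f b\<bar> \<le> g b"
proof -
  have "f b \<le> g b"
    by (rule deriv_comparison[OF \<open>a \<le> b\<close> _ f g]) (use assms(2,3) le in \<open>auto simp: abs_le_iff\<close>)
  moreover have "- f b \<le> g b"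
    by (rule deriv_comparison[OF \<open>a \<le> b\<close> _ DERIV_minus[OF f] g])
       (use assms(2,3) le in \<open>auto simp: abs_le_iff\<close>)
  ultimately show ?thesis by simp
qed

text \<open>The signed integral from 0 to \<open>x\<close>: the interval of one of the two terms is
  empty or a point. Covering negative \<open>x\<close> makes the derivative at 0 two-sided.\<close>

definition primitive :: "(real \<Rightarrow> real) \<Rightarrow> real \<Rightarrow> real" where
  "primitive f x = integral {0..x} f - integral {x..0} f"

lemma primitive_0 [simp]: "primitive f 0 = 0"
  by (simp add: primitive_def)

text \<open>On a window \<open>{-a<..<a}\<close> containing both 0 and \<open>x\<close>,
  \<open>primitive f\<close> differs from the integral starting at \<open>-a\<close> only by a
  constant, so the fundamental theorem applies at an interior point.\<close>

lemma primitive_deriv: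
  assumes "continuous_on UNIV f"
  shows "(primitive f has_real_derivative f x) (at x)"
proof -
  define a where "a = \<bar>x\<bar> + 1"
  have int: "f integrable_on {c..d}" for c d
    by (intro integrable_continuous_real continuous_on_subset[OF assms]) auto
  have eq: "primitive f t = integral {-a..t} f - integral {-a..0} f" if "t \<in> {-a<..<a}" for t
  proof (cases "t \<ge> 0")
    case True
    then have "integral {-a..0} f + integral {0..t} f = integral {-a..t} f"
      by (intro Henstock_Kurzweil_Integration.integral_combine int) (auto simp: a_def)
    moreover have "integral {t..0} f = 0" using True by (cases "t = 0") auto
    ultimately show ?thesis by (simp add: primitive_def)
  next
    case False
    then have "integral {-a..t} f + integral {t..0} f = integral {-a..0} f"
      by (intro Henstock_Kurzweil_Integration.integral_combine int) (use that in auto)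
    with False show ?thesis by (simp add: primitive_def)
  qed
  have "((\<lambda>t. integral {-a..t} f) has_real_derivative f x) (at x within {-a..a})"
    by (rule integral_has_real_derivative[OF continuous_on_subset[OF assms]]) (auto simp: a_def)
  then have "((\<lambda>t. integral {-a..t} f) has_real_derivative f x) (at x)"
    by (subst (asm) at_within_interior) (auto simp: a_def)
  then have "((\<lambda>t. integral {-a..t} f - integral {-a..0} f) has_real_derivative f x) (at x)"
    by (auto intro!: derivative_eq_intros)
  then show ?thesis
    by (rule has_field_derivative_transform_within_open[where S = "{-a<..<a}"])
       (auto simp: eq a_def)
qed

section \<open>The fixed point equation\<close>

text \<open>The projection onto [0,1]. It makes the quadratic nonlinearity bounded and globally
  Lipschitz.\<close>

definition clamp01 :: "real \<Rightarrow> real" where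
  "clamp01 x = max 0 (min 1 x)"

lemma clamp01_range: "0 \<le> clamp01 x" "clamp01 x \<le> 1"
  by (auto simp: clamp01_def)

lemma clamp01_sq_le: "(clamp01 x)\<^sup>2 \<le> 1"
  using clamp01_range[of x] by (simp add: power_le_one)

lemma clamp01_sq_lipschitz: "\<bar>(clamp01 x)\<^sup>2 - (clamp01 y)\<^sup>2\<bar> \<le> 2 * \<bar>x - y\<bar>"
proof -
  have "\<bar>(clamp01 x)\<^sup>2 - (clamp01 y)\<^sup>2\<bar> = \<bar>clamp01 x - clamp01 y\<bar> * (clamp01 x + clamp01 y)"
    using clamp01_range[of x] clamp01_range[of y]
    by (simp add: power2_eq_square square_diff_square_factored abs_mult)
  also have "\<dots> \<le> \<bar>x - y\<bar> * 2"
    using clamp01_range[of x] clamp01_range[of y]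
    by (intro mult_mono) (auto simp: clamp01_def)
  finally show ?thesis by simp
qed

lemma continuous_clamp01 [continuous_intros]:
  "continuous_on S f \<Longrightarrow> continuous_on S (\<lambda>x. clamp01 (f x))"
  unfolding clamp01_def by (intro continuous_intros)

section \<open>The integral operator and its a priori bounds\<close>

definition mass :: "(real \<Rightarrow> real) \<Rightarrow> real \<Rightarrow> real" where
  "mass v = primitive (\<lambda>t. t * (clamp01 (v t))\<^sup>2)"

text \<open>The function F of the overview, with truncated \<open>v\<close>; at a fixed point it
  equals r v' + n v.\<close>

definition flux :: "nat \<Rightarrow> (real \<Rightarrow> real) \<Rightarrow> real \<Rightarrow> real" where
  "flux n v r = n - (real n - 1) * mass v r - 3/2 * r\<^sup>2 * (clamp01 (v r))\<^sup>2"

definition moment :: "nat \<Rightarrow> (real \<Rightarrow> real) \<Rightarrow> real \<Rightarrow> real" where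
  "moment n v = primitive (\<lambda>t. t ^ (n - 1) * flux n v t)"

text \<open>The value 1 at the origin is the limit of the quotient: \<open>flux n v 0 = n\<close>,
  so the moment behaves like r^n.\<close>

definition picard :: "nat \<Rightarrow> (real \<Rightarrow> real) \<Rightarrow> real \<Rightarrow> real" where
  "picard n v r = (if r = 0 then 1 else moment n v r / r ^ n)"

lemma mass_deriv:
  assumes "continuous_on UNIV v"
  shows "(mass v has_real_derivative r * (clamp01 (v r))\<^sup>2) (at r)"
  unfolding mass_def by (rule primitive_deriv) (intro continuous_intros assms)

lemma mass_continuous:
  assumes "continuous_on UNIV v"
  shows "continuous_on S (mass v)"
  by (meson mass_deriv[OF assms] DERIV_isCont continuous_at_imp_continuous_on)

lemma flux_continuous:
  assumes "continuous_on UNIV v"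
  shows "continuous_on UNIV (flux n v)"
  unfolding flux_def by (intro continuous_intros assms mass_continuous)

lemma flux_0 [simp]: "flux n v 0 = n"
  by (simp add: flux_def mass_def)

lemma moment_deriv:
  assumes "continuous_on UNIV v"
  shows "(moment n v has_real_derivative r ^ (n - 1) * flux n v r) (at r)"
  unfolding moment_def by (rule primitive_deriv) (intro continuous_intros assms flux_continuous)

lemma mass_bounds:
  assumes "continuous_on UNIV v" "r \<ge> 0"
  shows "0 \<le> mass v r" "mass v r \<le> r\<^sup>2 / 2"
proof -
  have "mass v 0 \<le> mass v r"
    by (rule nonneg_increment[OF assms(2) mass_deriv[OF assms(1)]]) auto
  then show "0 \<le> mass v r" by (simp add: mass_def)
  show "mass v r \<le> r\<^sup>2 / 2"
  proof (rule deriv_comparison[OF assms(2) _ mass_deriv[OF assms(1)]])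
    show "((\<lambda>x. x\<^sup>2 / 2) has_real_derivative x) (at x)" for x :: real
      by (auto intro!: derivative_eq_intros)
  qed (auto simp: mass_def clamp01_sq_le mult_left_le)
qed

text \<open>Both subtracted terms are nonnegative, and truncation at 1 bounds them by (n-1)/2 r^2
  and 3/2 r^2, whose sum is (n+2)/2 r^2.\<close>

lemma flux_bounds:
  assumes "continuous_on UNIV v" "r \<ge> 0" "n \<ge> 1"
  shows "flux n v r \<le> n" "real n - (real n + 2) / 2 * r\<^sup>2 \<le> flux n v r"
proof -
  have *: "0 \<le> (real n - 1) * mass v r"
    using mass_bounds[OF assms(1,2)] assms(3) by simp
  have "(real n - 1) * mass v r \<le> (real n - 1) * (r\<^sup>2 / 2)"
    using mass_bounds[OF assms(1,2)] assms(3) by (intro mult_left_mono) auto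
  moreover
  have "3/2 * r\<^sup>2 * (clamp01 (v r))\<^sup>2 \<le> 3/2 * r\<^sup>2 * 1"
    by (intro mult_left_mono clamp01_sq_le) auto
  ultimately show "real n - (real n + 2) / 2 * r\<^sup>2 \<le> flux n v r"
    by (simp add: flux_def algebra_simps add_divide_distrib)
  show "flux n v r \<le> n" using add_nonneg_nonneg[OF * mult_nonneg_nonneg[of "3/2 * r\<^sup>2" "(clamp01 (v r))\<^sup>2"]]
    by (simp add: flux_def)
qed

text \<open>Integrating the bounds of \<open>flux_bounds\<close> against t^(n-1) gives r^n and r^n -
  r^(n+2)/2. The upper bound disposes of the truncation at 1; the lower one controls the behaviour
  at the origin.\<close>

lemma picard_bounds:
  assumes v: "continuous_on UNIV v" and "r \<ge> 0" "n \<ge> 1"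
  shows "picard n v r \<le> 1" "1 - r\<^sup>2 / 2 \<le> picard n v r"
proof -
  have up: "moment n v r \<le> r ^ n"
  proof (rule deriv_comparison[OF \<open>r \<ge> 0\<close> _ moment_deriv[OF v]])
    show "((\<lambda>x. x ^ n) has_real_derivative n * x ^ (n - 1)) (at x)" for x :: real
      by (auto intro!: derivative_eq_intros)
    show "x ^ (n - 1) * flux n v x \<le> n * x ^ (n - 1)" if "0 \<le> x" for x :: real
      using mult_left_mono[OF flux_bounds(1)[OF v that \<open>n \<ge> 1\<close>], of "x ^ (n - 1)"] that
      by (simp add: mult.commute)
  qed (use assms in \<open>simp add: moment_def power_0_left\<close>)
  have lo: "r ^ n - r ^ (n + 2) / 2 \<le> moment n v r"
  proof (rule deriv_comparison[OF \<open>r \<ge> 0\<close> _ _ moment_deriv[OF v]])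
    show "((\<lambda>x. x ^ n - x ^ (n + 2) / 2) has_real_derivative
            x ^ (n - 1) * (real n - (real n + 2) / 2 * x\<^sup>2)) (at x)" for x :: real
      by (rule derivative_eq_intros refl | simp)+
         (use \<open>n \<ge> 1\<close> in \<open>cases n; simp add: algebra_simps power2_eq_square add_divide_distrib\<close>)
    show "x ^ (n - 1) * (real n - (real n + 2) / 2 * x\<^sup>2) \<le> x ^ (n - 1) * flux n v x" if "0 \<le> x" for x :: real
      using flux_bounds(2)[OF v that \<open>n \<ge> 1\<close>] that by (intro mult_left_mono) auto
  qed (use assms in \<open>simp add: moment_def power_0_left\<close>)
  show "picard n v r \<le> 1" "1 - r\<^sup>2 / 2 \<le> picard n v r"
    using up lo \<open>r \<ge> 0\<close> by (auto simp: picard_def field_simps power_add power2_eq_square)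
qed

lemma picard_continuous:
  assumes v: "continuous_on UNIV v" and "n \<ge> 1"
  shows "continuous_on {0..} (picard n v)"
  unfolding continuous_on_eq_continuous_within
proof
  fix r :: real assume "r \<in> {0..}"
  show "continuous (at r within {0..}) (picard n v)"
  proof (cases "r = 0")
    case True
    have "((\<lambda>x. picard n v x) \<longlongrightarrow> 1) (at 0 within {0..})"
    proof (rule real_tendsto_sandwich)
      show "\<forall>\<^sub>F x in at 0 within {0..}. 1 - x\<^sup>2 / 2 \<le> picard n v x"
        "\<forall>\<^sub>F x in at 0 within {0..}. picard n v x \<le> 1"
        using picard_bounds[OF v _ \<open>n \<ge> 1\<close>] by (auto simp: eventually_at_filter)
      show "((\<lambda>x::real. 1 - x\<^sup>2 / 2) \<longlongrightarrow> 1) (at 0 within {0..})"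
        by (auto intro!: tendsto_eq_intros)
    qed simp
    then show ?thesis using True by (simp add: continuous_within picard_def[of n v 0])
  next
    case False
    then have "r > 0" using \<open>r \<in> {0..}\<close> by simp
    have "isCont (\<lambda>x. moment n v x / x ^ n) r"
      using \<open>r > 0\<close> by (intro continuous_intros DERIV_isCont[OF moment_deriv[OF v]]) auto
    moreover have "\<forall>\<^sub>F x in nhds r. picard n v x = moment n v x / x ^ n"
      by (rule eventually_mono[OF eventually_nhds_in_open[of "{0<..}" r]])
         (use \<open>r > 0\<close> in \<open>auto simp: picard_def\<close>)
    ultimately have "isCont (picard n v) r"
      by (simp cong: isCont_cong)
    then show ?thesis using continuous_at_imp_continuous_at_within by blast
  qed
qed

text \<open>The weight pays for the Lipschitz constant: integrating 2 d x exp(5 x^2) gains a factor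
  1/10, which gives d/5 for \<open>mass\<close>. The flux difference is then dominated by the
  derivative of (d/2) r^n exp(5 r^2), divided by r^(n-1).\<close>

lemma picard_contraction:
  assumes u: "continuous_on UNIV u" and v: "continuous_on UNIV v"
    and "n \<ge> 1" "d \<ge> 0" "r \<ge> 0"
    and uv: "\<And>t. t \<ge> 0 \<Longrightarrow> \<bar>u t - v t\<bar> \<le> d * exp (5 * t\<^sup>2)"
  shows "\<bar>picard n u r - picard n v r\<bar> \<le> d / 2 * exp (5 * r\<^sup>2)"
proof -
  have sq: "\<bar>(clamp01 (u t))\<^sup>2 - (clamp01 (v t))\<^sup>2\<bar> \<le> 2 * d * exp (5 * t\<^sup>2)" if "t \<ge> 0" for t
    using clamp01_sq_lipschitz[of "u t" "v t"] uv[OF that] by argo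
  have mass: "\<bar>mass u t - mass v t\<bar> \<le> d / 5 * exp (5 * t\<^sup>2)" if "t \<ge> 0" for t
  proof (rule deriv_comparison_abs[OF that _ _ DERIV_diff[OF mass_deriv[OF u] mass_deriv[OF v]]])
    show "((\<lambda>x. d / 5 * exp (5 * x\<^sup>2)) has_real_derivative x * (2 * d * exp (5 * x\<^sup>2))) (at x)"
      for x :: real by (auto intro!: derivative_eq_intros)
    show "\<bar>x * (clamp01 (u x))\<^sup>2 - x * (clamp01 (v x))\<^sup>2\<bar> \<le> x * (2 * d * exp (5 * x\<^sup>2))"
      if "0 \<le> x" for x
      using mult_left_mono[OF sq[OF that] that] that
      by (simp add: abs_mult flip: right_diff_distrib)
  qed (use \<open>d \<ge> 0\<close> in \<open>auto simp: mass_def\<close>)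
  have flux: "\<bar>flux n u t - flux n v t\<bar> \<le> d * exp (5 * t\<^sup>2) * (n / 2 + 5 * t\<^sup>2)" if "t \<ge> 0" for t
  proof -
    have "flux n u t - flux n v t = - ((real n - 1) * (mass u t - mass v t)) -
        3/2 * t\<^sup>2 * ((clamp01 (u t))\<^sup>2 - (clamp01 (v t))\<^sup>2)"
      by (simp add: flux_def algebra_simps)
    also have "\<bar>\<dots>\<bar> \<le> (real n - 1) * \<bar>mass u t - mass v t\<bar> +
        3/2 * t\<^sup>2 * \<bar>(clamp01 (u t))\<^sup>2 - (clamp01 (v t))\<^sup>2\<bar>"
      using abs_triangle_ineq4[of "- ((real n - 1) * (mass u t - mass v t))"
          "3/2 * t\<^sup>2 * ((clamp01 (u t))\<^sup>2 - (clamp01 (v t))\<^sup>2)"] \<open>n \<ge> 1\<close>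
      by (simp add: abs_mult)
    also have "\<dots> \<le> (real n - 1) * (d / 5 * exp (5 * t\<^sup>2)) + 3/2 * t\<^sup>2 * (2 * d * exp (5 * t\<^sup>2))"
      using \<open>n \<ge> 1\<close> by (intro add_mono mult_left_mono mass sq that) auto
    also have "\<dots> = d * exp (5 * t\<^sup>2) * ((real n - 1) / 5 + 3 * t\<^sup>2)"
      by (simp add: algebra_simps add_divide_distrib diff_divide_distrib)
    \<comment> \<open>The bracket is enlarged to match the derivative of x^n exp(5 x^2) exactly;
      this is where the contraction factor 1/2 appears.\<close>
    also have "\<dots> \<le> d * exp (5 * t\<^sup>2) * (n / 2 + 5 * t\<^sup>2)"
      using \<open>d \<ge> 0\<close> by (intro mult_left_mono add_mono) auto
    finally show ?thesis .
  qed
  have "\<bar>moment n u r - moment n v r\<bar> \<le> d / 2 * (r ^ n * exp (5 * r\<^sup>2))"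
  proof (rule deriv_comparison_abs[OF \<open>r \<ge> 0\<close> _ _ DERIV_diff[OF moment_deriv[OF u] moment_deriv[OF v]]])
    show "((\<lambda>x. d / 2 * (x ^ n * exp (5 * x\<^sup>2))) has_real_derivative
        x ^ (n - 1) * (d * exp (5 * x\<^sup>2) * (n / 2 + 5 * x\<^sup>2))) (at x)" for x :: real
      by (rule derivative_eq_intros refl)+
         (use \<open>n \<ge> 1\<close> in \<open>cases n; simp add: algebra_simps power2_eq_square add_divide_distrib\<close>)
    show "\<bar>x ^ (n - 1) * flux n u x - x ^ (n - 1) * flux n v x\<bar>
        \<le> x ^ (n - 1) * (d * exp (5 * x\<^sup>2) * (n / 2 + 5 * x\<^sup>2))" if "0 \<le> x" for x
      using mult_left_mono[OF flux[OF that], of "x ^ (n - 1)"] that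
      by (simp add: abs_mult flip: right_diff_distrib)
  qed (use assms in \<open>auto simp: moment_def\<close>)
  then show ?thesis using \<open>r \<ge> 0\<close> \<open>d \<ge> 0\<close>
    by (auto simp: picard_def field_simps abs_mult simp flip: diff_divide_distrib)
qed

text \<open>Banach's theorem is applied to X = exp(-5 t^2) v in the space of bounded continuous
  functions, where the weighted estimate becomes a contraction in the supremum distance.\<close>

lemma picard_fixed_point:
  assumes "n \<ge> 1"
  obtains v where "continuous_on UNIV v" "\<And>r. r \<ge> 0 \<Longrightarrow> v r = picard n v r"
proof -
  define lift where "lift X = (\<lambda>t. apply_bcontfun X t * exp (5 * t\<^sup>2))" for X :: "real \<Rightarrow>\<^sub>C real"
  \<comment> \<open>Bounded continuous functions live on the whole line while \<open>picard\<close>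
    is controlled only for r >= 0, hence the even extension through the absolute value.\<close>
  define op where "op X = (\<lambda>r. exp (- 5 * r\<^sup>2) * picard n (lift X) \<bar>r\<bar>)" for X
  have lift: "continuous_on UNIV (lift X)" for X
    unfolding lift_def by (intro continuous_intros) auto
  have bcont: "op X \<in> bcontfun" for X
  proof (rule bcontfun_normI)
    have "continuous_on UNIV (\<lambda>r. picard n (lift X) \<bar>r\<bar>)"
      by (rule continuous_on_compose2[OF picard_continuous[OF lift assms]]) (auto intro!: continuous_intros)
    then show "continuous_on UNIV (op X)"
      unfolding op_def by (intro continuous_intros)
    fix r
    have "\<bar>picard n (lift X) \<bar>r\<bar>\<bar> \<le> 1 + r\<^sup>2"
      using picard_bounds[OF lift[of X] abs_ge_zero[of r] assms] unfolding power2_abs by arith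
    also have "\<dots> \<le> exp (r\<^sup>2)" by simp
    also have "\<dots> \<le> exp (5 * r\<^sup>2)" by simp
    finally show "norm (op X r) \<le> 1"
      by (simp add: op_def abs_mult exp_minus field_simps)
  qed
  have contr: "dist (Bcontfun (op X)) (Bcontfun (op Y)) \<le> 1/2 * dist X Y" for X Y
  proof (rule dist_bound)
    fix r
    have "\<bar>lift X t - lift Y t\<bar> \<le> dist X Y * exp (5 * t\<^sup>2)" for t
      using mult_right_mono[OF dist_bounded[of X t Y], of "exp (5 * t\<^sup>2)"]
      by (simp add: lift_def dist_real_def abs_mult flip: left_diff_distrib)
    then have "\<bar>picard n (lift X) \<bar>r\<bar> - picard n (lift Y) \<bar>r\<bar>\<bar> \<le> dist X Y / 2 * exp (5 * \<bar>r\<bar>\<^sup>2)"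
      by (intro picard_contraction lift assms) auto
    then have "exp (- 5 * r\<^sup>2) * \<bar>picard n (lift X) \<bar>r\<bar> - picard n (lift Y) \<bar>r\<bar>\<bar> \<le> dist X Y / 2"
      by (simp add: exp_minus field_simps)
    moreover have "\<bar>op X r - op Y r\<bar>
        = exp (- 5 * r\<^sup>2) * \<bar>picard n (lift X) \<bar>r\<bar> - picard n (lift Y) \<bar>r\<bar>\<bar>"
      by (simp add: op_def abs_mult flip: right_diff_distrib)
    ultimately show "dist (apply_bcontfun (Bcontfun (op X)) r) (apply_bcontfun (Bcontfun (op Y)) r)
        \<le> 1/2 * dist X Y"
      by (simp add: Bcontfun_inverse bcont dist_real_def)
  qed
  obtain X where "Bcontfun (op X) = X"
    using banach_fix_type[of "1/2" "\<lambda>X. Bcontfun (op X)"] contr by auto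
  then have X: "apply_bcontfun X = op X"
    using Bcontfun_inverse[OF bcont] by metis
  show thesis
  proof
    show "continuous_on UNIV (lift X)" by (rule lift)
    show "lift X r = picard n (lift X) r" if "r \<ge> 0" for r
    proof -
      have "lift X r = op X r * exp (5 * r\<^sup>2)" by (simp add: lift_def X)
      then show ?thesis using that by (simp add: op_def exp_minus)
    qed
  qed
qed

section \<open>Positivity\<close>

text \<open>The first zero is the infimum of the closed set where f <= 0; the intermediate value
  theorem excludes a negative value there.\<close>

lemma first_zero:
  fixes f :: "real \<Rightarrow> real"
  assumes "a \<le> b" and f: "continuous_on {a..b} f" and "f a > 0" "f b \<le> 0"
  obtains c where "a < c" "c \<le> b" "f c = 0" "\<And>t. a \<le> t \<Longrightarrow> t < c \<Longrightarrow> f t > 0"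
proof -
  define S where "S = {x \<in> {a..b}. f x \<le> 0}"
  have "closed S" unfolding S_def
    by (rule continuous_on_closed_Collect_le[OF f]) (auto intro: continuous_intros)
  moreover have "b \<in> S" using assms by (simp add: S_def)
  moreover have bdd: "bdd_below S" by (auto simp: S_def)
  ultimately have "Inf S \<in> S" using closed_contains_Inf[of S] by blast
  have pos: "f t > 0" if "a \<le> t" "t < Inf S" for t
  proof (rule ccontr)
    assume "\<not> f t > 0"
    with that \<open>Inf S \<in> S\<close> have "t \<in> S" by (auto simp: S_def)
    then show False using cInf_lower[OF _ bdd] that by force
  qed
  have "f (Inf S) = 0"
  proof -
    have "\<exists>x\<ge>a. x \<le> Inf S \<and> f x = 0"
      using \<open>Inf S \<in> S\<close> \<open>f a > 0\<close>
      by (intro IVT2') (auto simp: S_def intro: continuous_on_subset[OF f])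
    then show ?thesis using pos by force
  qed
  moreover have "a \<noteq> Inf S" using \<open>f (Inf S) = 0\<close> \<open>f a > 0\<close> by auto
  ultimately show thesis using that[of "Inf S"] pos \<open>Inf S \<in> S\<close> by (auto simp: S_def)
qed

text \<open>At a first zero the function arrives from positive values, which a positive derivative
  forbids. The derivative hypothesis may use positivity up to the point considered, so coupled
  inequalities can be propagated together.\<close>

lemma positive_if_increasing_at_zeros:
  fixes f :: "real \<Rightarrow> real"
  assumes "a \<le> b" "continuous_on {a..b} f" "f a > 0"
    and deriv: "\<And>r. \<lbrakk>a < r; r \<le> b; f r = 0; \<And>t. a \<le> t \<Longrightarrow> t < r \<Longrightarrow> f t > 0\<rbrakk>
      \<Longrightarrow> \<exists>D>0. (f has_real_derivative D) (at r)"
  shows "f b > 0"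
proof (rule ccontr)
  assume "\<not> f b > 0"
  then obtain c where c: "a < c" "c \<le> b" "f c = 0" "\<And>t. a \<le> t \<Longrightarrow> t < c \<Longrightarrow> f t > 0"
    using first_zero[OF assms(1-3)] by (auto simp: not_less)
  obtain D where "D > 0" "(f has_real_derivative D) (at c)"
    using deriv[OF c(1,2,3)] c(4) by blast
  then obtain d where d: "d > 0" "\<And>h. 0 < h \<Longrightarrow> h < d \<Longrightarrow> f (c - h) < 0"
    using DERIV_pos_inc_left c(3) by metis
  define h where "h = min (d / 2) (c - a)"
  have "0 < h" "h < d" "a \<le> c - h" using d(1) c(1) by (auto simp: h_def)
  then have "f (c - h) < 0" "f (c - h) > 0" using d(2) c(4) by auto
  then show False by simp
qed

text \<open>The equation as a first-order system, with \<open>y = r v' + n v\<close>.\<close>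

locale profile =
  fixes n :: nat and v y :: "real \<Rightarrow> real"
  assumes n_ge_2: "n \<ge> 2"
    and v_cont: "continuous_on {0..} v" and y_cont: "continuous_on {0..} y"
    and v_0: "v 0 = 1" and y_0: "y 0 = n"
    and v_deriv: "\<And>r. r > 0 \<Longrightarrow> (v has_real_derivative (y r - n * v r) / r) (at r)"
    and y_deriv: "\<And>r. r > 0 \<Longrightarrow>
      (y has_real_derivative r * v r * (2 * (real n - 1) * v r - 3 * y r)) (at r)"
    and v_pos: "\<And>r. r \<ge> 0 \<Longrightarrow> v r > 0"
    and v_near_0: "\<And>r. r \<ge> 0 \<Longrightarrow> \<bar>v r - 1\<bar> \<le> r\<^sup>2 / 2"
    and slope_near_0: "\<And>r. r \<ge> 0 \<Longrightarrow> \<bar>y r - n * v r\<bar> \<le> (real n + 2) / 2 * r\<^sup>2"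

section \<open>From the fixed point to a positive solution of the first-order system\<close>

lemma picard_fixed_point_deriv:
  assumes v: "continuous_on UNIV v" and fp: "\<And>r. r \<ge> 0 \<Longrightarrow> v r = picard n v r"
    and "n \<ge> 1" "r > 0"
  shows "(v has_real_derivative (flux n v r - n * v r) / r) (at r)"
proof -
  obtain m where n: "n = Suc m" using \<open>n \<ge> 1\<close> by (cases n) auto
  have "v r = moment n v r / r ^ n" using fp[of r] \<open>r > 0\<close> by (simp add: picard_def)
  then have moment: "moment n v r = v r * r ^ n" using \<open>r > 0\<close> by simp
  have "((\<lambda>t. moment n v t / t ^ n) has_real_derivative
      (r ^ (n - 1) * flux n v r * r ^ n - moment n v r * (n * r ^ (n - 1))) / (r ^ n * r ^ n)) (at r)"
    using \<open>r > 0\<close> by (auto intro!: derivative_eq_intros moment_deriv[OF v])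
  also have "(r ^ (n - 1) * flux n v r * r ^ n - moment n v r * (n * r ^ (n - 1))) / (r ^ n * r ^ n)
      = (flux n v r - n * v r) / r"
    using \<open>r > 0\<close> unfolding moment by (simp add: n field_simps)
  finally show ?thesis
    by (rule has_field_derivative_transform_within_open[where S = "{0<..}"])
       (use \<open>r > 0\<close> fp in \<open>auto simp: picard_def\<close>)
qed

text \<open>Positivity before \<open>b\<close>, together with v <= 1, makes the truncation inactive
  there, and substituting r v' = F - n v closes the system. The horizon \<open>b\<close> lets the
  formula be used while positivity is still being proved.\<close>

lemma picard_fixed_point_flux_deriv:
  assumes v: "continuous_on UNIV v" and fp: "\<And>r. r \<ge> 0 \<Longrightarrow> v r = picard n v r"
    and "n \<ge> 1" and r: "0 < r" "r < b" and pos: "\<And>t. 0 \<le> t \<Longrightarrow> t < b \<Longrightarrow> v t > 0"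
  shows "(flux n v has_real_derivative r * v r * (2 * (real n - 1) * v r - 3 * flux n v r)) (at r)"
proof -
  have clamp: "clamp01 (v t) = v t" if "0 < t" "t < b" for t
    using pos[of t] picard_bounds(1)[OF v _ \<open>n \<ge> 1\<close>, of t] fp[of t] that by (simp add: clamp01_def)
  define v' where "v' = (flux n v r - n * v r) / r"
  have [derivative_intros]: "(v has_real_derivative v') (at r)"
    unfolding v'_def using picard_fixed_point_deriv[OF v fp \<open>n \<ge> 1\<close> r(1)] by simp
  have v': "flux n v r = r * v' + n * v r" using r by (simp add: v'_def)
  have "((\<lambda>t. n - (real n - 1) * mass v t - 3/2 * t\<^sup>2 * (v t)\<^sup>2) has_real_derivative
      - (real n - 1) * (r * (clamp01 (v r))\<^sup>2) - 3 * r * (v r)\<^sup>2 - 3 * r\<^sup>2 * v r * v') (at r)"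
    by (auto intro!: derivative_eq_intros mass_deriv[OF v] simp: field_simps)
  also have "- (real n - 1) * (r * (clamp01 (v r))\<^sup>2) - 3 * r * (v r)\<^sup>2 - 3 * r\<^sup>2 * v r * v'
      = r * v r * (2 * (real n - 1) * v r - 3 * flux n v r)"
    using clamp[OF r] unfolding v' by (simp add: algebra_simps power2_eq_square)
  finally show ?thesis
    by (rule has_field_derivative_transform_within_open[where S = "{0<..<b}"])
       (use r in \<open>auto simp: flux_def clamp\<close>)
qed

text \<open>Up to a first zero \<open>c\<close> of \<open>v\<close> the flux stays positive, so the
  moment r^n v increases strictly from 0 and cannot vanish at \<open>c\<close>.\<close>

lemma picard_fixed_point_pos:
  assumes v: "continuous_on UNIV v" and fp: "\<And>r. r \<ge> 0 \<Longrightarrow> v r = picard n v r" and "n \<ge> 2"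
    and "r \<ge> 0"
  shows "v r > 0"
proof (rule ccontr)
  have "n \<ge> 1" using \<open>n \<ge> 2\<close> by simp
  assume "\<not> v r > 0"
  moreover have "v 0 = 1" using fp[of 0] by (simp add: picard_def)
  ultimately obtain c where c: "0 < c" "v c = 0" "\<And>t. 0 \<le> t \<Longrightarrow> t < c \<Longrightarrow> v t > 0"
    using first_zero[OF \<open>r \<ge> 0\<close> continuous_on_subset[OF v]] by (auto simp: not_less)
  \<comment> \<open>At a zero of the flux its derivative reduces to 2(n-1) s v^2, which is positive
    since n >= 2.\<close>
  have flux_pos: "flux n v t > 0" if t: "0 < t" "t < c" for t
  proof (rule positive_if_increasing_at_zeros[of 0 t])
    fix s assume s: "0 < s" "s \<le> t" "flux n v s = 0"
    have "v s > 0" using c(3)[of s] s t by simp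
    have "(flux n v has_real_derivative s * v s * (2 * (real n - 1) * v s)) (at s)"
      using picard_fixed_point_flux_deriv[OF v fp \<open>n \<ge> 1\<close> s(1) _ c(3), where b = c] s t by simp
    moreover have "s * v s * (2 * (real n - 1) * v s) > 0"
      using s \<open>v s > 0\<close> \<open>n \<ge> 2\<close> by simp
    ultimately show "\<exists>D>0. (flux n v has_real_derivative D) (at s)" by blast
  qed (use t \<open>n \<ge> 2\<close> in \<open>auto intro: continuous_on_subset[OF flux_continuous[OF v]]\<close>)
  have "moment n v 0 < moment n v c"
  proof (rule DERIV_pos_imp_increasing_open[OF \<open>0 < c\<close>])
    show "\<exists>D. (moment n v has_real_derivative D) (at t) \<and> D > 0" if "0 < t" "t < c" for t
      using moment_deriv[OF v, of n t] flux_pos[OF that] that by (auto intro!: exI)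
    show "continuous_on {0..c} (moment n v)"
      by (meson moment_deriv[OF v] DERIV_isCont continuous_at_imp_continuous_on)
  qed
  then have "v c > 0" using fp[of c] c(1) by (simp add: picard_def moment_def)
  then show False using c(2) by simp
qed

lemma profile_exists:
  assumes "n \<ge> 2"
  obtains v y where "profile n v y"
proof -
  have "n \<ge> 1" using assms by simp
  obtain v where v: "continuous_on UNIV v" and fp: "\<And>r. r \<ge> 0 \<Longrightarrow> v r = picard n v r"
    using picard_fixed_point[OF \<open>n \<ge> 1\<close>] by blast

  have "profile n v (flux n v)"
  proof
    show "continuous_on {0..} v" "continuous_on {0..} (flux n v)"
      by (auto intro: continuous_on_subset[OF v] continuous_on_subset[OF flux_continuous[OF v]])
    show "v 0 = 1" "flux n v 0 = n" using fp[of 0] by (auto simp: picard_def)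
    fix r :: real
    show "(v has_real_derivative (flux n v r - n * v r) / r) (at r)" if "r > 0"
      by (rule picard_fixed_point_deriv[OF v fp \<open>n \<ge> 1\<close> that])
    show "(flux n v has_real_derivative r * v r * (2 * (real n - 1) * v r - 3 * flux n v r)) (at r)"
      if "r > 0"
      by (rule picard_fixed_point_flux_deriv[OF v fp \<open>n \<ge> 1\<close> that, of "r + 1"])
         (use picard_fixed_point_pos[OF v fp assms] in auto)
    show "v r > 0" if "r \<ge> 0" by (rule picard_fixed_point_pos[OF v fp assms that])
    show "\<bar>v r - 1\<bar> \<le> r\<^sup>2 / 2" if "r \<ge> 0"
      using picard_bounds[OF v that \<open>n \<ge> 1\<close>] fp[OF that] by auto
    \<comment> \<open>Here n v lies between n - (n/2) r^2 and n, and F between n - (n/2 + 1) r^2 and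
      n, so the difference is at most (n/2 + 1) r^2 in absolute value.\<close>
    have "n * v r \<le> n * 1" "n * (1 - r\<^sup>2 / 2) \<le> n * v r" if "r \<ge> 0"
      using mult_left_mono[of "v r" 1 n] mult_left_mono[of "1 - r\<^sup>2 / 2" "v r" n]
        picard_bounds[OF v that \<open>n \<ge> 1\<close>] fp[OF that] by simp_all
    moreover have "n * (1 - r\<^sup>2 / 2) = n - n / 2 * r\<^sup>2"
      by (simp add: algebra_simps)
    moreover have eq: "(real n + 2) / 2 * r\<^sup>2 = n / 2 * r\<^sup>2 + r\<^sup>2"
      by (simp add: algebra_simps add_divide_distrib)
    moreover have "0 \<le> n / 2 * r\<^sup>2" "0 \<le> r\<^sup>2" by simp_all
    ultimately have "flux n v r - n * v r \<le> (real n + 2) / 2 * r\<^sup>2"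
      "- (flux n v r - n * v r) \<le> (real n + 2) / 2 * r\<^sup>2" if "r \<ge> 0"
      using flux_bounds[OF v that \<open>n \<ge> 1\<close>, unfolded eq] that unfolding eq by linarith+
    then show "\<bar>flux n v r - n * v r\<bar> \<le> (real n + 2) / 2 * r\<^sup>2" if "r \<ge> 0"
      using that by (simp only: abs_le_iff)
  qed (use assms in auto)
  then show thesis by (rule that)
qed

section \<open>Asymptotics\<close>

text \<open>The limit is the supremum; keeping \<open>f a\<close> as a lower bound is what makes the
  limiting constants positive for n < 4 and n > 4.\<close>

lemma increasing_bounded_limit:
  fixes f :: "real \<Rightarrow> real"
  assumes mono: "\<And>x y. a \<le> x \<Longrightarrow> x \<le> y \<Longrightarrow> f x \<le> f y" and bound: "\<And>x. a \<le> x \<Longrightarrow> f x \<le> B"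
  obtains c where "(f \<longlongrightarrow> c) at_top" "f a \<le> c"
proof -
  define c where "c = (SUP x\<in>{a..}. f x)"
  have bdd: "bdd_above (f ` {a..})" using bound by (auto intro!: bdd_aboveI2)
  have le: "f x \<le> c" if "a \<le> x" for x
    unfolding c_def by (rule cSUP_upper[OF _ bdd]) (use that in auto)
  have "(f \<longlongrightarrow> c) at_top"
  proof (rule increasing_tendsto)
    show "\<forall>\<^sub>F x in at_top. f x \<le> c"
      using eventually_ge_at_top[of a] by eventually_elim (rule le)
    fix l assume "l < c"
    then obtain x where x: "x \<ge> a" "l < f x"
      unfolding c_def using less_cSUP_iff[OF _ bdd, of l] by auto
    show "\<forall>\<^sub>F z in at_top. l < f z"
      using eventually_ge_at_top[of x] by eventually_elim (use mono[OF x(1)] x(2) in force)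
  qed
  then show thesis using that le by auto
qed

section \<open>The variable w = r^2 v and its first-order quantities\<close>

context profile
begin

lemma w_deriv:
  assumes "r > 0"
  shows "((\<lambda>r. r\<^sup>2 * v r) has_real_derivative r * (y r - (real n - 2) * v r)) (at r)"
proof -
  have "((\<lambda>r. r\<^sup>2 * v r) has_real_derivative 2 * r * v r + r\<^sup>2 * ((y r - n * v r) / r)) (at r)"
    by (auto intro!: derivative_eq_intros v_deriv assms)
  also have "2 * r * v r + r\<^sup>2 * ((y r - n * v r) / r) = r * (y r - (real n - 2) * v r)"
    using assms by (simp add: field_simps power2_eq_square)
  finally show ?thesis .
qed

text \<open>Used with b = n for r v', with b = (2n-2)/3 for m / r^2, and with b = n-2 for w' /
  r.\<close>

lemma combination_deriv:
  assumes "r > 0"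
  shows "((\<lambda>r. y r - b * v r) has_real_derivative
    r * v r * (2 * (real n - 1) * v r - 3 * y r) - b * ((y r - n * v r) / r)) (at r)"
  by (auto intro!: derivative_eq_intros v_deriv y_deriv assms)

lemma combination_cont: "S \<subseteq> {0..} \<Longrightarrow> continuous_on S (\<lambda>r. y r - b * v r)"
  by (intro continuous_intros continuous_on_subset[OF v_cont] continuous_on_subset[OF y_cont])

text \<open>The constant is the one for which 2(n-1) v - 3y vanishes at a zero of the difference.
  Only -b (y - n v)/s remains, and it is positive because b < n. In terms of w this says m >
  0.\<close>

lemma y_lower:
  assumes "r \<ge> 0"
  shows "y r > (2 * real n - 2) / 3 * v r"
proof -
  let ?b = "(2 * real n - 2) / 3"
  have "0 < y r - ?b * v r"
  proof (rule positive_if_increasing_at_zeros[OF assms])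
    fix s assume s: "0 < s" "y s - ?b * v s = 0"
    then have y: "y s = ?b * v s" by simp
    have "s * v s * (2 * (real n - 1) * v s - 3 * y s) - ?b * ((y s - n * v s) / s)
        = ?b * (real n + 2) / 3 * (v s / s)"
      using s unfolding y by (simp add: field_simps)
    also have "\<dots> > 0" using n_ge_2 v_pos[of s] s by simp
    finally show "\<exists>D>0. ((\<lambda>r. y r - ?b * v r) has_real_derivative D) (at s)"
      using combination_deriv[OF s(1)] by blast
  next
    show "continuous_on {0..r} (\<lambda>r. y r - ?b * v r)" by (rule combination_cont) auto
    show "0 < y 0 - ?b * v 0" using v_0 y_0 by simp
  qed
  then show ?thesis by simp
qed

text \<open>With \<open>w = r\<^sup>2 v\<close> the function differentiated here is \<open>m = r w' - h w\<close>.\<close>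

lemma excess_deriv:
  fixes h
  defines "h \<equiv> (4 - real n) / 3"
  assumes "r > 0"
  shows "((\<lambda>r. r\<^sup>2 * (y r - (2 * real n - 2) / 3 * v r)) has_real_derivative
    ((2 * h - 3 * (r\<^sup>2 * v r)) * (r\<^sup>2 * (y r - (2 * real n - 2) / 3 * v r))
      + (2 * h\<^sup>2 + 2 * (real n - 2)) * (r\<^sup>2 * v r)) / r) (at r)"
proof -
  let ?b = "(2 * real n - 2) / 3"
  have "((\<lambda>r. r\<^sup>2 * (y r - ?b * v r)) has_real_derivative 2 * r * (y r - ?b * v r)
      + r\<^sup>2 * (r * v r * (2 * (real n - 1) * v r - 3 * y r) - ?b * ((y r - n * v r) / r))) (at r)"
    using DERIV_mult[OF DERIV_pow[of 2 r] combination_deriv[OF assms(2), of ?b]] by (simp add: ac_simps)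
  also have "2 * r * (y r - ?b * v r)
      + r\<^sup>2 * (r * v r * (2 * (real n - 1) * v r - 3 * y r) - ?b * ((y r - n * v r) / r))
    = ((2 * h - 3 * (r\<^sup>2 * v r)) * (r\<^sup>2 * (y r - ?b * v r))
      + (2 * h\<^sup>2 + 2 * (real n - 2)) * (r\<^sup>2 * v r)) / r"
    using \<open>r > 0\<close> by (simp add: h_def field_simps power2_eq_square)
  finally show ?thesis .
qed

lemma w_mono:
  assumes "\<And>r. r > 0 \<Longrightarrow> y r \<ge> (real n - 2) * v r" "0 < a" "a \<le> b"
  shows "a\<^sup>2 * v a \<le> b\<^sup>2 * v b"
  by (rule nonneg_increment[OF \<open>a \<le> b\<close> w_deriv]) (use assms in auto)

text \<open>Two inequalities support each other: q = y - (n-2) v > 0 (w increases) keeps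
  \<open>e\<close> positive, and \<open>e\<close> > 0 prevents q from reaching zero. Together they
  bound w by 2/k.\<close>

lemma limit_gt_4:
  assumes "n > 4"
  shows "\<exists>c>0. ((\<lambda>r. r\<^sup>2 * v r) \<longlongrightarrow> c) at_top"
proof -
  define k where "k = (real n - 4) / (real n - 2)"
  have k: "k * (real n - 2) = real n - 4" "0 < k" "k < 1"
    using assms by (auto simp: k_def)
  \<comment> \<open>\<open>r\<^sup>2 e = 2 w - k w\<^sup>2 - r w'\<close>, the distance to the barrier\<close>
  define e where "e r = n * v r - y r - k * r\<^sup>2 * (v r)\<^sup>2" for r
  \<comment> \<open>The factor r^n is an integrating factor: with it the derivative becomes a
    positive multiple of q for r > 0.\<close>
  have e_deriv: "((\<lambda>r. r ^ n * e r) has_real_derivative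
      (3 - 2 * k) * r ^ (n + 1) * v r * (y r - (real n - 2) * v r)) (at r)" if "r > 0" for r
  proof -
    define v' where "v' = (y r - n * v r) / r"
    have y: "y r = r * v' + n * v r" using that by (simp add: v'_def)
    have [derivative_intros]: "(v has_real_derivative v') (at r)"
      unfolding v'_def by (rule v_deriv[OF that])
    have "((\<lambda>r. r ^ n * e r) has_real_derivative n * r ^ (n - 1) * e r + r ^ n *
        (n * v' - r * v r * (2 * (real n - 1) * v r - 3 * y r) - 2 * k * r * (v r)\<^sup>2
          - 2 * k * r\<^sup>2 * v r * v')) (at r)"
      unfolding e_def
      by (auto intro!: derivative_eq_intros y_deriv that simp: algebra_simps power2_eq_square)
    also have "n * r ^ (n - 1) * e r + r ^ n *
        (n * v' - r * v r * (2 * (real n - 1) * v r - 3 * y r) - 2 * k * r * (v r)\<^sup>2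
          - 2 * k * r\<^sup>2 * v r * v')
      = r ^ (n - 1) * (n * e r + r * (n * v' - r * v r * (2 * (real n - 1) * v r - 3 * y r)
          - 2 * k * r * (v r)\<^sup>2 - 2 * k * r\<^sup>2 * v r * v'))"
      using assms by (cases n) (auto simp: algebra_simps)
    also have "n * e r + r * (n * v' - r * v r * (2 * (real n - 1) * v r - 3 * y r)
          - 2 * k * r * (v r)\<^sup>2 - 2 * k * r\<^sup>2 * v r * v')
      = r\<^sup>2 * v r * (3 * y r - 2 * (real n - 1) * v r - k * (real n - 2) * v r - 2 * k * (r * v' + 2 * v r))"
      unfolding e_def y by (simp add: algebra_simps power2_eq_square)
    \<comment> \<open>By k (n-2) = n-4 the coefficients of v add up to 3(n-2), and r v' + 2 v = q,
      so everything factors through q. This is what determines k.\<close>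
    also have "\<dots> = r\<^sup>2 * v r * ((3 - 2 * k) * (y r - (real n - 2) * v r))"
      unfolding k(1) y by (simp add: algebra_simps)
    finally show ?thesis
      using assms by (cases n) (auto simp: algebra_simps power2_eq_square)
  qed
  have e_pos: "e r > 0" if "r > 0" and q: "\<And>t. 0 < t \<Longrightarrow> t < r \<Longrightarrow> y t > (real n - 2) * v t" for r
  proof -
    \<comment> \<open>The factor r^n vanishes at 0, so strict growth alone gives positivity.\<close>
    have "0 ^ n * e 0 < r ^ n * e r"
    proof (rule DERIV_pos_imp_increasing_open[OF \<open>r > 0\<close>])
      show "\<exists>D. ((\<lambda>r. r ^ n * e r) has_real_derivative D) (at t) \<and> D > 0" if t: "0 < t" "t < r" for t
        by (rule exI, rule conjI[OF e_deriv[OF t(1)]]) (use q[OF t] v_pos[of t] \<open>k < 1\<close> t in simp)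
      show "continuous_on {0..r} (\<lambda>r. r ^ n * e r)"
        unfolding e_def
        by (intro continuous_intros continuous_on_subset[OF v_cont] continuous_on_subset[OF y_cont]) auto
    qed
    then have "0 < r ^ n * e r" using assms by (simp add: power_0_left)
    then show ?thesis using zero_less_mult_pos[OF _ zero_less_power[OF \<open>r > 0\<close>]] by blast
  qed
  have q_pos: "y r - (real n - 2) * v r > 0" if "r \<ge> 0" for r
  proof (rule positive_if_increasing_at_zeros[OF that])
    fix s assume s: "0 < s" "y s - (real n - 2) * v s = 0"
      and before: "\<And>t. 0 \<le> t \<Longrightarrow> t < s \<Longrightarrow> 0 < y t - (real n - 2) * v t"
    then have y: "y s = (real n - 2) * v s" by simp
    \<comment> \<open>Where q = 0, the barrier reads w (2 - k w) > 0, that is w < 2/k =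
      2(n-2)/(n-4). This is exactly the condition for q to have positive derivative.\<close>
    have "e s > 0" by (rule e_pos[OF s(1)]) (use before in force)
    moreover have "e s = v s * (2 - k * (s\<^sup>2 * v s))"
      unfolding e_def y by (simp add: algebra_simps power2_eq_square)
    ultimately have "2 - k * (s\<^sup>2 * v s) > 0" using v_pos[of s] s by (simp add: zero_less_mult_iff)
    then have "(real n - 2) * (2 - k * (s\<^sup>2 * v s)) > 0" using assms by simp
    moreover have "(real n - 2) * (2 - k * (s\<^sup>2 * v s)) = 2 * (real n - 2) - (k * (real n - 2)) * (s\<^sup>2 * v s)"
      by (simp add: algebra_simps)
    ultimately have "v s / s * (2 * (real n - 2) - (real n - 4) * (s\<^sup>2 * v s)) > 0"
      unfolding k(1) using v_pos[of s] s by simp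
    also have "v s / s * (2 * (real n - 2) - (real n - 4) * (s\<^sup>2 * v s))
      = s * v s * (2 * (real n - 1) * v s - 3 * y s) - (real n - 2) * ((y s - n * v s) / s)"
      unfolding y using s by (simp add: field_simps power2_eq_square)
    finally show "\<exists>D>0. ((\<lambda>r. y r - (real n - 2) * v r) has_real_derivative D) (at s)"
      using combination_deriv[OF s(1)] by blast
  qed (use v_0 y_0 in \<open>auto intro: combination_cont\<close>)
  have bound: "r\<^sup>2 * v r \<le> 2 / k" if "r \<ge> 1" for r
  proof -
    have "e r > 0" by (rule e_pos) (use q_pos that in force)+
    then have "v r * (2 - k * (r\<^sup>2 * v r)) > y r - (real n - 2) * v r"
      unfolding e_def by (simp add: algebra_simps power2_eq_square)
    then have "v r * (2 - k * (r\<^sup>2 * v r)) > 0" using q_pos[of r] that by simp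
    then show ?thesis using v_pos[of r] that k by (simp add: zero_less_mult_iff field_simps)
  qed
  have mono: "a\<^sup>2 * v a \<le> b\<^sup>2 * v b" if "1 \<le> a" "a \<le> b" for a b
    by (rule w_mono) (use q_pos that in \<open>force intro: less_imp_le\<close>)+
  obtain c where "((\<lambda>r. r\<^sup>2 * v r) \<longlongrightarrow> c) at_top" "1\<^sup>2 * v 1 \<le> c"
    by (rule increasing_bounded_limit[of 1 "\<lambda>r. r\<^sup>2 * v r" "2 / k", OF mono bound])
  moreover from this have "c > 0" using v_pos[of 1] by simp
  ultimately show ?thesis by blast
qed

text \<open>For n <= 4 the exponent h is nonnegative, so m > 0 already gives r w' > h w >=
  0.\<close>

lemma w_mono_le_4:
  assumes "n \<le> 4" "0 < a" "a \<le> b"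
  shows "a\<^sup>2 * v a \<le> b\<^sup>2 * v b"
proof (rule w_mono[OF _ assms(2,3)])
  fix r :: real assume "r > 0"
  have "(real n - 2) * v r \<le> (2 * real n - 2) / 3 * v r"
    using assms(1) v_pos[of r] \<open>r > 0\<close> by (intro mult_right_mono) auto
  then show "(real n - 2) * v r \<le> y r" using y_lower[of r] \<open>r > 0\<close> by simp
qed

text \<open>Since (n+2)/3 = 2 - h, the function \<open>u\<close> is r^(-h) w, with derivative
  r^(-h-1) m. It increases because m > 0, and stays bounded once m is bounded.\<close>

lemma limit_lt_4:
  assumes "n < 4"
  shows "\<exists>c>0. ((\<lambda>r. r powr ((real n + 2) / 3) * v r) \<longlongrightarrow> c) at_top"
proof -
  define h where "h = (4 - real n) / 3"
  have h: "0 < h" "h < 1" using assms n_ge_2 by (auto simp: h_def)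
  define m where "m r = r\<^sup>2 * (y r - (2 * real n - 2) / 3 * v r)" for r
  define w where "w r = r\<^sup>2 * v r" for r
  define u where "u r = r powr ((real n + 2) / 3) * v r" for r
  define c where "c = 2 * h\<^sup>2 + 2 * (real n - 2)"
  have m_pos: "m r > 0" if "r > 0" for r
    using y_lower[of r] that by (simp add: m_def)
  have m_deriv: "(m has_real_derivative ((2 * h - 3 * w r) * m r + c * w r) / r) (at r)" if "r > 0" for r
    using excess_deriv[OF that] unfolding m_def w_def c_def h_def .
  have u_deriv: "(u has_real_derivative r powr (- h - 1) * m r) (at r)" if "r > 0" for r
  proof -
    have "(u has_real_derivative (real n + 2) / 3 * r powr ((real n + 2) / 3 - 1) * v r
        + r powr ((real n + 2) / 3) * ((y r - n * v r) / r)) (at r)"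
      unfolding u_def using that by (auto intro!: derivative_eq_intros v_deriv)
    also have "r powr ((real n + 2) / 3) = r * r powr ((real n + 2) / 3 - 1)"
      using powr_mult_base[of r "(real n + 2) / 3 - 1"] that by simp
    also have "(real n + 2) / 3 * r powr ((real n + 2) / 3 - 1) * v r
        + r * r powr ((real n + 2) / 3 - 1) * ((y r - n * v r) / r)
      = r powr ((real n + 2) / 3 - 1) * (y r - (2 * real n - 2) / 3 * v r)"
      using that by (simp add: field_simps)
    also have "r powr ((real n + 2) / 3 - 1) = r powr (- h - 1) * r\<^sup>2"
    proof -
      have "(real n + 2) / 3 - 1 = (- h - 1) + 2" by (simp add: h_def field_simps)
      then show ?thesis using that by (simp only: powr_add powr_numeral)
    qed
    finally show ?thesis by (simp add: m_def mult.assoc)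
  qed
  have w_u: "w r = r powr h * u r" if "r > 0" for r
  proof -
    have "h + (real n + 2) / 3 = 2" by (simp add: h_def field_simps)
    then have "r\<^sup>2 = r powr (h + (real n + 2) / 3)" using that by simp
    then show ?thesis by (simp add: w_def u_def powr_add)
  qed
  have u_mono: "u a \<le> u b" if "0 < a" "a \<le> b" for a b
  proof (rule nonneg_increment[OF \<open>a \<le> b\<close> u_deriv])
    show "0 \<le> x powr (- h - 1) * m x" if "a \<le> x" for x
      using m_pos[of x] \<open>0 < a\<close> that by simp
  qed (use that in auto)
  have u1: "u 1 > 0" using v_pos[of 1] by (simp add: u_def)
  \<comment> \<open>Beyond this radius r^h u(1) >= 1, hence w >= 1 by monotonicity of
    \<open>u\<close>.\<close>
  define R where "R = max 1 ((1 / u 1) powr (1 / h))"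
  have w_ge_1: "w r \<ge> 1" if "r \<ge> R" for r
  proof -
    have r: "r \<ge> 1" "(1 / u 1) powr (1 / h) \<le> r" using that by (auto simp: R_def)
    have "1 / u 1 = ((1 / u 1) powr (1 / h)) powr h" using h u1 by (simp add: powr_powr)
    also have "\<dots> \<le> r powr h" using r h by (intro powr_mono2) auto
    finally have "1 \<le> r powr h * u 1" using u1 by (simp add: field_simps)
    also have "\<dots> \<le> w r" using u_mono[of 1 r] r by (simp add: w_u)
    finally show ?thesis .
  qed
  have R: "R \<ge> 1" by (simp add: R_def)
  \<comment> \<open>At m = K with w >= 1 > h, the damping 3w - 2h exceeds w, so r m' < (c - K) w <=
    0 and m cannot reach K. The added 1 makes the initial inequality strict.\<close>
  define K where "K = max c (m R) + 1"
  have m_le: "m r < K" if "r \<ge> R" for r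
  proof -
    have "0 < K - m r"
    proof (rule positive_if_increasing_at_zeros[OF that])
      have "isCont m t" if "t > 0" for t using m_deriv[OF that] DERIV_isCont by blast
      then show "continuous_on {R..r} (\<lambda>r. K - m r)"
        using R by (intro continuous_intros continuous_at_imp_continuous_on) auto
      show "0 < K - m R" by (simp add: K_def)
      fix s assume s: "R < s" "K - m s = 0"
      have "s > 0" "w s \<ge> 1" "m s = K" using s R w_ge_1[of s] by auto
      have K: "K > 0" "c \<le> K" using m_pos[of R] R by (auto simp: K_def)
      have "c * w s \<le> K * w s" using K \<open>w s \<ge> 1\<close> by (intro mult_right_mono) auto
      moreover have "2 * h * K < 2 * w s * K" using h K \<open>w s \<ge> 1\<close> by (intro mult_strict_right_mono) auto
      ultimately have "(2 * h - 3 * w s) * K + c * w s < 0" by (simp add: algebra_simps)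
      then have "- (((2 * h - 3 * w s) * K + c * w s) / s) > 0"
        using \<open>s > 0\<close> by (simp add: divide_neg_pos)
      moreover have "((\<lambda>r. K - m r) has_real_derivative - (((2 * h - 3 * w s) * K + c * w s) / s)) (at s)"
        using m_deriv[OF \<open>s > 0\<close>] \<open>m s = K\<close> by (auto intro!: derivative_eq_intros)
      ultimately show "\<exists>D>0. ((\<lambda>r. K - m r) has_real_derivative D) (at s)" by blast
    qed
    then show ?thesis by simp
  qed
  have bound: "u r \<le> u R + K / h * R powr (- h)" if "r \<ge> R" for r
  proof -
    \<comment> \<open>The right-hand side is u(R) plus the integral of K x^(-h-1) from R to
      r.\<close>
    have "u r \<le> u R + K / h * R powr (- h) - K / h * r powr (- h)"
    proof (rule deriv_comparison[OF that])
      show "(u has_real_derivative x powr (- h - 1) * m x) (at x)" if "R \<le> x" for x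
        using u_deriv[of x] R that by simp
      show "((\<lambda>x. u R + K / h * R powr (- h) - K / h * x powr (- h)) has_real_derivative
          x powr (- h - 1) * K) (at x)" if "R \<le> x" for x
        using R h that by (auto intro!: derivative_eq_intros)
      show "x powr (- h - 1) * m x \<le> x powr (- h - 1) * K" if "R \<le> x" for x
        using m_le[OF that] by (intro mult_left_mono) auto
    qed simp
    moreover have "K / h * r powr (- h) \<ge> 0" using h m_pos[of R] R by (auto simp: K_def)
    ultimately show ?thesis by simp
  qed
  obtain l where "(u \<longlongrightarrow> l) at_top" "u R \<le> l"
    by (rule increasing_bounded_limit[of R u, OF u_mono bound]) (use R in auto)
  moreover from this have "l > 0" using u1 u_mono[OF zero_less_one R] by simp
  ultimately show ?thesis unfolding u_def by blast
qed

text \<open>Here h = 0 and \<open>d\<close> = 4/3 - r w' satisfies r d' = -3 w d. As w >= w(1) for r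
  >= 1, \<open>d\<close> decays at least like r^(-a) with a = 3 w(1), so \<open>G\<close> has the
  integrable derivative -d/r.\<close>

lemma limit_eq_4:
  assumes "n = 4"
  shows "\<exists>C. ((\<lambda>r. r\<^sup>2 * v r - 4 / 3 * ln r) \<longlongrightarrow> C) at_top"
proof -
  define w where "w r = r\<^sup>2 * v r" for r
  define d where "d r = 4 / 3 - r\<^sup>2 * (y r - 2 * v r)" for r
  define a where "a = 3 * w 1"
  define A where "A = \<bar>d 1\<bar>"
  define G where "G r = w r - 4 / 3 * ln r" for r
  have a: "a > 0" using v_pos[of 1] by (simp add: a_def w_def)
  have d_deriv: "(d has_real_derivative - 3 * w r * d r / r) (at r)" if "r > 0" for r
  proof -
    have "(d has_real_derivative 0 - ((- 3 * w r) * (r\<^sup>2 * (y r - 2 * v r)) + 4 * w r) / r) (at r)"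
      unfolding d_def
      by (intro DERIV_diff DERIV_const) (use excess_deriv[OF that] assms in \<open>simp add: w_def\<close>)
    also have "0 - ((- 3 * w r) * (r\<^sup>2 * (y r - 2 * v r)) + 4 * w r) / r = - 3 * w r * d r / r"
      using that by (simp add: d_def field_simps)
    finally show ?thesis .
  qed
  have d_le: "\<bar>d r\<bar> \<le> A * r powr (- a)" if "r \<ge> 1" for r
  proof -
    \<comment> \<open>Squaring avoids differentiating the absolute value; d^2 r^(2a) is
      nonincreasing because 3 w >= a.\<close>
    have "- ((d 1)\<^sup>2 * 1 powr (2 * a)) \<le> - ((d r)\<^sup>2 * r powr (2 * a))"
    proof (rule nonneg_increment[OF that])
      show "((\<lambda>r. - ((d r)\<^sup>2 * r powr (2 * a))) has_real_derivative
          2 * (3 * w x - a) * (d x)\<^sup>2 * x powr (2 * a) / x) (at x)" if "1 \<le> x" for x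
        using that
        by (auto intro!: derivative_eq_intros d_deriv simp: powr_diff field_simps power2_eq_square)
      show "0 \<le> 2 * (3 * w x - a) * (d x)\<^sup>2 * x powr (2 * a) / x" if "1 \<le> x" for x
        using w_mono_le_4[of 1 x] assms that by (simp add: a_def w_def)
    qed
    then have "(\<bar>d r\<bar> * r powr a)\<^sup>2 \<le> A\<^sup>2"
      using that by (simp add: A_def power_mult_distrib powr_powr mult.commute[of 2] flip: powr_numeral)
    then have "\<bar>d r\<bar> * r powr a \<le> A" by (rule power2_le_imp_le) (simp add: A_def)
    then show ?thesis using that by (simp add: powr_minus field_simps)
  qed
  have G_deriv: "(G has_real_derivative - d r / r) (at r)" if "r > 0" for r
  proof -
    have "(G has_real_derivative r * (y r - (real n - 2) * v r) - 4 / 3 * (1 / r)) (at r)"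
      unfolding G_def w_def by (intro DERIV_diff w_deriv DERIV_cmult DERIV_ln_divide that)
    also have "r * (y r - (real n - 2) * v r) - 4 / 3 * (1 / r) = - d r / r"
      using that assms by (simp add: d_def field_simps power2_eq_square)
    finally show ?thesis .
  qed
  have P_deriv: "((\<lambda>r. A / a * r powr (- a)) has_real_derivative - (A * r powr (- a) / r)) (at r)"
    if "r > 0" for r
    using that a by (auto intro!: derivative_eq_intros simp: powr_diff field_simps)
  have d_over: "d r / r \<le> A * r powr (- a) / r" "- d r / r \<le> A * r powr (- a) / r"
    if "r \<ge> 1" for r
    by (intro divide_right_mono; use d_le[OF that] that in simp)+
  \<comment> \<open>The sign of G' is unknown. Subtracting A/a r^(-a) adds A r^(-a-1) to the
    derivative, which dominates d/r, so \<open>H\<close> is monotone; the subtracted term vanishes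
    at infinity.\<close>
  define H where "H r = G r - A / a * r powr (- a)" for r
  have mono: "H r \<le> H s" if "1 \<le> r" "r \<le> s" for r s
    unfolding H_def
  proof (rule nonneg_increment[OF that(2)])
    show "((\<lambda>r. G r - A / a * r powr (- a)) has_real_derivative - d x / x - - (A * x powr (- a) / x)) (at x)"
      if "r \<le> x" for x
      by (intro DERIV_diff G_deriv P_deriv) (use that \<open>1 \<le> r\<close> in auto)
    show "0 \<le> - d x / x - - (A * x powr (- a) / x)" if "r \<le> x" for x
      using d_over[of x] that \<open>1 \<le> r\<close> by simp
  qed
  have bound: "H r \<le> G 1 + A / a" if "1 \<le> r" for r
  proof -
    \<comment> \<open>Adding the same correction instead gives a nonincreasing function lying above
      \<open>H\<close>.\<close>
    have "- (G 1 + A / a * 1 powr (- a)) \<le> - (G r + A / a * r powr (- a))"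
    proof (rule nonneg_increment[OF that])
      show "((\<lambda>r. - (G r + A / a * r powr (- a))) has_real_derivative
          - (- d x / x + - (A * x powr (- a) / x))) (at x)" if "1 \<le> x" for x
        by (intro DERIV_minus DERIV_add G_deriv P_deriv) (use that in auto)
      show "0 \<le> - (- d x / x + - (A * x powr (- a) / x))" if "1 \<le> x" for x
        using d_over[of x] that by simp
    qed
    moreover have "A / a * r powr (- a) \<ge> 0" using a by (simp add: A_def)
    ultimately show ?thesis by (simp add: H_def)
  qed
  obtain l where "(H \<longlongrightarrow> l) at_top"
    using increasing_bounded_limit[of 1 H, OF mono bound] by blast
  moreover have "((\<lambda>r. A / a * r powr (- a)) \<longlongrightarrow> A / a * 0) at_top"
    by (intro tendsto_intros tendsto_neg_powr filterlim_ident) (use a in auto)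
  ultimately have "((\<lambda>r. H r + A / a * r powr (- a)) \<longlongrightarrow> l + A / a * 0) at_top"
    by (rule tendsto_add)
  then show ?thesis by (auto simp: H_def G_def w_def)
qed

text \<open>The second derivative is read off from y' = r v'' + (n+1) v'. At the origin division by
  zero gives V'(0) = 0, which agrees with the one-sided derivative there.\<close>

lemma solves_ode:
  fixes V' :: "real \<Rightarrow> real"
  defines "V' \<equiv> \<lambda>r. (y r - n * v r) / r"
  shows "solves_ode_halfline n v V'
    (\<lambda>r. (r * v r * (2 * (real n - 1) * v r - 3 * y r) - (n + 1) * V' r) / r)"
  unfolding solves_ode_halfline_def
proof (intro conjI allI impI)
  have small: "\<bar>V' r\<bar> \<le> (real n + 2) / 2 * r" if "r \<ge> 0" for r
  proof (cases "r = 0")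
    case False
    then show ?thesis using slope_near_0[OF that] that
      by (simp add: V'_def field_simps power2_eq_square)
  qed (simp add: V'_def)
  fix r :: real
  show "(v has_real_derivative V' r) (at r within {0..})" if "r \<ge> 0"
  proof (cases "r = 0")
    case True
    \<comment> \<open>By \<open>v_near_0\<close> the difference quotient is at most x/2;
      \<open>slope_near_0\<close> plays the same role below for the continuity of \<open>V'\<close>
      at 0.\<close>
    have "((\<lambda>x. (v x - v 0) / (x - 0)) \<longlongrightarrow> 0) (at 0 within {0..})"
    proof (rule Lim_null_comparison)
      have "\<bar>v x - 1\<bar> / x \<le> x / 2" if "x > 0" for x
        using divide_right_mono[OF v_near_0, of x x] that by (simp add: power2_eq_square)
      then show "\<forall>\<^sub>F x in at 0 within {0..}. norm ((v x - v 0) / (x - 0)) \<le> x / 2"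
        by (auto simp: eventually_at_filter v_0)
      show "((\<lambda>x::real. x / 2) \<longlongrightarrow> 0) (at 0 within {0..})" by (auto intro!: tendsto_eq_intros)
    qed
    then show ?thesis using True by (simp add: has_field_derivative_iff V'_def)
  next
    case False
    then show ?thesis unfolding V'_def using v_deriv[of r] that
      by (auto intro: has_field_derivative_at_within)
  qed
  have V'_deriv: "(V' has_real_derivative
      (r * v r * (2 * (real n - 1) * v r - 3 * y r) - (n + 1) * V' r) / r) (at r)" if "r > 0" for r
  proof -
    have "(V' has_real_derivative ((r * v r * (2 * (real n - 1) * v r - 3 * y r)
        - n * V' r) * r - (y r - n * v r) * 1) / (r * r)) (at r)"
      unfolding V'_def using that
      by (intro DERIV_divide combination_deriv DERIV_ident) auto
    also have "((r * v r * (2 * (real n - 1) * v r - 3 * y r)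
        - n * V' r) * r - (y r - n * v r) * 1) / (r * r)
      = (r * v r * (2 * (real n - 1) * v r - 3 * y r) - (n + 1) * V' r) / r"
      using that by (simp add: V'_def field_simps)
    finally show ?thesis .
  qed
  show "(V' has_real_derivative
      (r * v r * (2 * (real n - 1) * v r - 3 * y r) - (n + 1) * V' r) / r) (at r)" if "r > 0"
    by (rule V'_deriv[OF that])
  show "continuous_on {0..} V'"
    unfolding continuous_on_eq_continuous_within
  proof
    fix x :: real assume "x \<in> {0..}"
    show "continuous (at x within {0..}) V'"
    proof (cases "x = 0")
      case True
      have "(V' \<longlongrightarrow> 0) (at 0 within {0..})"
      proof (rule Lim_null_comparison)
        show "\<forall>\<^sub>F x in at 0 within {0..}. norm (V' x) \<le> (real n + 2) / 2 * x"
          using small by (auto simp: eventually_at_filter)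
        show "((\<lambda>x::real. (real n + 2) / 2 * x) \<longlongrightarrow> 0) (at 0 within {0..})"
          by (auto intro!: tendsto_eq_intros)
      qed
      moreover have "V' 0 = 0" by (simp add: V'_def)
      ultimately show ?thesis using True by (simp add: continuous_within)
    next
      case False
      then have "x > 0" using \<open>x \<in> {0..}\<close> by simp
      from V'_deriv[OF this] show ?thesis
        by (meson continuous_at_imp_continuous_at_within DERIV_isCont)
    qed
  qed
  show "(r * v r * (2 * (real n - 1) * v r - 3 * y r) - (n + 1) * V' r) / r + (real n + 1) / r * V' r
      + 3 * r * v r * V' r + (real n + 2) * (v r)\<^sup>2 = 0" if "r > 0"
    using that by (simp add: V'_def field_simps power2_eq_square)
qed

end

theorem mainTheorem2:
  fixes n :: nat
  assumes "n \<ge> 2"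
  shows "\<exists>V V' V'' :: real \<Rightarrow> real.
           solves_ode_halfline n V V' V'' \<and>
           (\<forall>r\<ge>0. V r > 0) \<and> V 0 = 1 \<and> V' 0 = 0 \<and>
           (1 < n \<and> n < 4 \<longrightarrow>
              (\<exists>c>0. ((\<lambda>r. r powr ((real n + 2) / 3) * V r) \<longlongrightarrow> c) at_top)) \<and>
           (n = 4 \<longrightarrow>
              (\<exists>C. ((\<lambda>r. r\<^sup>2 * V r - 4 / 3 * ln r) \<longlongrightarrow> C) at_top)) \<and>
           (n > 4 \<longrightarrow>
              (\<exists>c>0. ((\<lambda>r. r\<^sup>2 * V r) \<longlongrightarrow> c) at_top))"
proof -
  obtain v y where "profile n v y" using profile_exists[OF assms] .
  then interpret profile n v y .
  show ?thesis
    by (rule exI[of _ v], rule exI, rule exI, intro conjI, rule solves_ode)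
       (use v_pos v_0 limit_lt_4 limit_eq_4 limit_gt_4 in auto)
qed

end
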